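(* Let $G$ be a weakly Hölder bipartite graph. Then: (i) For every subgraph $H\subseteq G$ (with $|V(H)|\ge 2$), $$\frac{|E(H)|}{|V(H)|-1}\le\frac{|E(G)|}{|V(G)|-1}.$$ (ii) If $u$ and $v$ belong to the same part in the bipartization of $G$, then $\deg(u)=\deg(v)$.
   Context: A bipartite graph is a triple $G=(X,Y;E)$ where $X,Y$ are disjoint finite sets and $E$ is a finite multi-set of elements of $X\times Y$ (multiple edges are allowed; the bipartization $(X,Y)$ is fixed as part of the data). Write $V(G)=X\cup Y$ and $E(G)=E$, with $|E|$ and degrees counted with multiplicity. For index sets $\mathcal{I},\mathcal{J}$ let $\mathcal{W}(\mathcal{I}\times\mathcal{J})=\{w:\mathcal{I}\times\mathcal{J}\to\mathbb{R}\}$. For $w\in\mathcal{W}(\mathcal{I}\times\mathcal{J})$ put $$h_G(w)=\sum_{x_a\in\mathcal{I}\ \forall a\in X}\ \sum_{y_b\in\mathcal{J}\ \forall b\in Y}\ \prod_{(u,v)\in E}w(x_u,y_v),\qquad \|w\|_{r(G)}=h_G(|w|)^{1/|E|},$$ where $|w|$ is the pointwise absolute value. $G$ is weakly Hölder if for all $\mathcal{I},\mathcal{J}$ and every choice of $\{w_e\in\mathcal{W}(\mathcal{I}\times\mathcal{J}):e\in E(G)\}$, $$\sum_{x_a\in\mathcal{I}\ \forall a\in X}\ \sum_{y_b\in\mathcal{J}\ \forall b\in Y}\ \prod_{e=(u,v)\in E(G)}w_e(x_u,y_v)\le\prod_{e\in E(G)}\|w_e\|_{r(G)} .$$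
   Formalization: Part (i) is proved for connected G and part (ii) for G without isolated vertices; without these the claims fail: two disjoint edges violate (i), and an edge plus an isolated vertex violates (ii), though both graphs are weakly Hölder. *)

theory Defs
  imports Complex_Main "HOL-Library.Multiset" "HOL-Library.FuncSet"
begin

record 'a bigraph =
  lpart :: "'a set"
  rpart :: "'a set"
  edges :: "('a \<times> 'a) multiset"

definition bipartite_graph :: "'a bigraph \<Rightarrow> bool" where
  "bipartite_graph G \<longleftrightarrow>
     finite (lpart G) \<and> finite (rpart G) \<and> lpart G \<inter> rpart G = {} \<and>
     set_mset (edges G) \<subseteq> lpart G \<times> rpart G"

definition verts :: "'a bigraph \<Rightarrow> 'a set" where
  "verts G = lpart G \<union> rpart G"

definition degree :: "'a bigraph \<Rightarrow> 'a \<Rightarrow> nat" where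
  "degree G v = size {#e \<in># edges G. fst e = v \<or> snd e = v#}"

definition subgraph :: "'a bigraph \<Rightarrow> 'a bigraph \<Rightarrow> bool" where
  "subgraph H G \<longleftrightarrow>
     bipartite_graph H \<and> lpart H \<subseteq> lpart G \<and> rpart H \<subseteq> rpart G \<and> edges H \<subseteq># edges G"

definition adjacent :: "'a bigraph \<Rightarrow> 'a \<Rightarrow> 'a \<Rightarrow> bool" where
  "adjacent G u v \<longleftrightarrow> (u, v) \<in># edges G \<or> (v, u) \<in># edges G"

text \<open>
  Two disjoint edges form a weakly Hoelder graph for which the density bound on subgraphs fails,
  and adding an isolated vertex preserves the property but not the equality of degrees, so the
  first claim is made for connected graphs and the second for graphs without isolated vertices.
\<close>
definition connected_bigraph :: "'a bigraph \<Rightarrow> bool" where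
  "connected_bigraph G \<longleftrightarrow> (\<forall>u\<in>verts G. \<forall>v\<in>verts G. (adjacent G)\<^sup>*\<^sup>* u v)"

definition no_isolated_vertices :: "'a bigraph \<Rightarrow> bool" where
  "no_isolated_vertices G \<longleftrightarrow> (\<forall>v\<in>verts G. degree G v > 0)"

text \<open>
  A family indexed by the edges of a multigraph assigns a separate member to each of the
  parallel edges, so it is indexed by pairs of an edge and a copy number below its multiplicity.
\<close>
definition edge_copies :: "'a bigraph \<Rightarrow> (('a \<times> 'a) \<times> nat) set" where
  "edge_copies G = {(e, i). i < count (edges G) e}"

text \<open>
  The summation variables \<open>x\<^sub>a \<in> I\<close> (\<open>a \<in> X\<close>) and \<open>y\<^sub>b \<in> J\<close> (\<open>b \<in> Y\<close>) are extensional functions.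
  A weight is a function on the whole type, but only its values on \<open>I \<times> J\<close> are ever used.
\<close>
definition hom_sum :: "'a bigraph \<Rightarrow> 'i set \<Rightarrow> 'j set \<Rightarrow> ('i \<times> 'j \<Rightarrow> real) \<Rightarrow> real" where
  "hom_sum G I J w =
     (\<Sum>x\<in>lpart G \<rightarrow>\<^sub>E I. \<Sum>y\<in>rpart G \<rightarrow>\<^sub>E J. \<Prod>(u, v)\<in>#edges G. w (x u, y v))"

definition r_norm :: "'a bigraph \<Rightarrow> 'i set \<Rightarrow> 'j set \<Rightarrow> ('i \<times> 'j \<Rightarrow> real) \<Rightarrow> real" where
  "r_norm G I J w = hom_sum G I J (\<lambda>p. \<bar>w p\<bar>) powr (1 / real (size (edges G)))"

text \<open>
  Index sets are finite, and since only their cardinality matters they can be taken as sets of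
  natural numbers (a quantifier inside a definition cannot range over types).
\<close>
definition weakly_holder :: "'a bigraph \<Rightarrow> bool" where
  "weakly_holder G \<longleftrightarrow>
     (\<forall>(I :: nat set) (J :: nat set) (w :: ('a \<times> 'a) \<times> nat \<Rightarrow> nat \<times> nat \<Rightarrow> real).
        finite I \<longrightarrow> finite J \<longrightarrow>
        (\<Sum>x\<in>lpart G \<rightarrow>\<^sub>E I. \<Sum>y\<in>rpart G \<rightarrow>\<^sub>E J.
           \<Prod>((u, v), k)\<in>edge_copies G. w ((u, v), k) (x u, y v))
        \<le> (\<Prod>e\<in>edge_copies G. r_norm G I J (w e)))"

end

theory Submission
  imports Defs
begin

text \<open>
  The Hoelder inequality is tested on weights with values in \<open>{0, 1}\<close>. Fix a relation \<open>R\<close> between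
  the index sets \<open>I\<close> and \<open>J\<close> and a sub-multiset \<open>F\<close> of the edges, give the edges in \<open>F\<close> the
  indicator of \<open>R\<close> as weight and all other edges the constant \<open>1\<close>. Both sides then count
  labellings \<open>(x, y)\<close> of the vertices, and with \<open>N(F)\<close> the number of labellings that satisfy \<open>R\<close>
  along every edge of \<open>F\<close> the inequality becomes
  \<open>N(F) ^ m \<le> N(E) ^ |F| * N({}) ^ (m - |F|)\<close>, where \<open>E\<close> is the edge multiset of \<open>G\<close> and \<open>m = |E|\<close>
  (lemma \<open>weakly_holder_labellings\<close>). Both claims come from a choice of \<open>R\<close> with two labels.

  For the density bound, \<open>R\<close> is equality on two labels. Let \<open>n\<close> and \<open>h\<close> be the numbers of vertices of
  \<open>G\<close> and of \<open>H\<close>. Connectedness gives \<open>N(E) \<le> 2\<close>, while \<open>N(E(H)) \<ge> 2 * 2 ^ (n - h)\<close>, because all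
  labellings that are constant on \<open>H\<close> count. Comparing exponents of \<open>2\<close> yields
  \<open>|E(H)| * (n - 1) \<le> m * (h - 1)\<close>.

  For the degrees, the vertices of one part \<open>P\<close> choose between two labels, all vertices of the other
  part have the label \<open>0\<close>, and \<open>R\<close> requires the label \<open>0\<close> at both ends of an edge. If no
  vertex is isolated then \<open>N(E) \<le> 1\<close>; and if \<open>F\<close> consists of the edges at a vertex \<open>v\<close> of \<open>P\<close>
  then \<open>N(F) \<ge> 2 ^ (|P| - 1)\<close>. Hence \<open>|P| * deg v \<le> m\<close>: no degree in \<open>P\<close> exceeds the average
  degree of \<open>P\<close>, so all of them are equal to it.
\<close>

section \<open>Edge copies\<close>

text \<open>
  The index set of edge families, for an arbitrary multiset: for \<open>F \<subseteq># M\<close> it makes \<open>copies F\<close> a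
  subset of \<open>copies M\<close>, which picks out the first \<open>count F e\<close> copies of each edge \<open>e\<close>.
\<close>
definition copies :: "'b multiset \<Rightarrow> ('b \<times> nat) set" where
  "copies M = {(e, i). i < count M e}"

lemma copies_eq_Sigma: "copies M = (SIGMA e:set_mset M. {..<count M e})"
  by (auto simp: copies_def) (metis count_inI not_less0)

lemma finite_copies: "finite (copies M)"
  by (simp add: copies_eq_Sigma)

lemma card_copies: "card (copies M) = size M"
  by (simp add: copies_eq_Sigma size_multiset_overloaded_eq)

lemma copies_mono: "F \<subseteq># M \<Longrightarrow> copies F \<subseteq> copies M"
  by (auto simp: copies_def subseteq_mset_def intro: less_le_trans)

lemma prod_copies:
  fixes f :: "'b \<Rightarrow> 'c :: comm_monoid_mult"
  shows "(\<Prod>(e, k)\<in>copies M. f e) = (\<Prod>e\<in>#M. f e)"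
proof -
  have "(\<Prod>(e, k)\<in>copies M. f e) = (\<Prod>e\<in>set_mset M. \<Prod>k<count M e. f e)"
    unfolding copies_eq_Sigma by (subst prod.Sigma) auto
  also have "\<dots> = (\<Prod>e\<in>#M. f e)"
    by (simp add: image_prod_mset_multiplicity)
  finally show ?thesis .
qed

lemma prod_copies_if:
  fixes f g :: "'b \<Rightarrow> 'c :: comm_monoid_mult"
  assumes "F \<subseteq># M"
  shows "(\<Prod>(e, k)\<in>copies M. if k < count F e then f e else c)
           = (\<Prod>e\<in>#F. f e) * c ^ (size M - size F)"
proof -
  have "(\<Prod>(e, k)\<in>copies M. if k < count F e then f e else c)
      = (\<Prod>(e, k)\<in>copies M - copies F. if k < count F e then f e else c)
        * (\<Prod>(e, k)\<in>copies F. if k < count F e then f e else c)"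
    by (rule prod.subset_diff[OF copies_mono[OF assms] finite_copies])
  also have "(\<Prod>(e, k)\<in>copies M - copies F. if k < count F e then f e else c)
      = (\<Prod>p\<in>copies M - copies F. c)"
    by (rule prod.cong) (auto simp: copies_def)
  also have "\<dots> = c ^ (size M - size F)"
    by (simp add: card_Diff_subset[OF finite_copies copies_mono[OF assms]] card_copies)
  also have "(\<Prod>(e, k)\<in>copies F. if k < count F e then f e else c) = (\<Prod>(e, k)\<in>copies F. f e)"
    by (rule prod.cong) (auto simp: copies_def)
  finally show ?thesis
    by (simp add: prod_copies mult.commute)
qed

section \<open>The Hoelder inequality for indicator weights\<close>

definition labellings ::
    "'a bigraph \<Rightarrow> ('a \<times> 'a) multiset \<Rightarrow> 'i set \<Rightarrow> 'j set \<Rightarrow> ('i \<Rightarrow> 'j \<Rightarrow> bool)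
      \<Rightarrow> (('a \<Rightarrow> 'i) \<times> ('a \<Rightarrow> 'j)) set" where
  "labellings G F I J R =
     {(x, y) \<in> (lpart G \<rightarrow>\<^sub>E I) \<times> (rpart G \<rightarrow>\<^sub>E J). \<forall>(u, v)\<in>#F. R (x u) (y v)}"

lemma finite_labellings:
  assumes "bipartite_graph G" "finite I" "finite J"
  shows "finite (labellings G F I J R)"
proof (rule finite_subset)
  show "labellings G F I J R \<subseteq> (lpart G \<rightarrow>\<^sub>E I) \<times> (rpart G \<rightarrow>\<^sub>E J)"
    by (auto simp: labellings_def)
  show "finite ((lpart G \<rightarrow>\<^sub>E I) \<times> (rpart G \<rightarrow>\<^sub>E J))"
    using assms by (auto simp: bipartite_graph_def intro!: finite_PiE)
qed

lemma prod_mset_of_bool: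
  "(\<Prod>e\<in>#M. of_bool (P e)) = (of_bool (\<forall>e\<in>#M. P e) :: 'c :: comm_semiring_1)"
  by (induction M) auto

lemma sum_indicator_weights:
  assumes "bipartite_graph G" "finite I" "finite J"
  shows "(\<Sum>x\<in>lpart G \<rightarrow>\<^sub>E I. \<Sum>y\<in>rpart G \<rightarrow>\<^sub>E J. \<Prod>(u, v)\<in>#F. of_bool (R (x u) (y v)))
           = real (card (labellings G F I J R))"
proof -
  let ?A = "(lpart G \<rightarrow>\<^sub>E I) \<times> (rpart G \<rightarrow>\<^sub>E J)"
  have fin: "finite ?A"
    using assms by (auto simp: bipartite_graph_def intro!: finite_PiE)
  have "(\<Sum>x\<in>lpart G \<rightarrow>\<^sub>E I. \<Sum>y\<in>rpart G \<rightarrow>\<^sub>E J. \<Prod>(u, v)\<in>#F. of_bool (R (x u) (y v)))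
      = (\<Sum>(x, y)\<in>?A. of_bool (\<forall>(u, v)\<in>#F. R (x u) (y v)) :: real)"
    by (simp add: sum.cartesian_product case_prod_unfold prod_mset_of_bool)
  also have "\<dots> = (\<Sum>p\<in>?A. if p \<in> labellings G F I J R then 1 else 0)"
    by (rule sum.cong) (auto simp: labellings_def)
  also have "\<dots> = (\<Sum>p\<in>labellings G F I J R. 1)"
    using fin
    by (subst sum.inter_restrict[symmetric]) (auto simp: labellings_def intro!: arg_cong[of _ _ card])
  finally show ?thesis by simp
qed

lemma powr_inverse_power:
  fixes a :: real
  assumes "a \<ge> 0" "m > 0"
  shows "(a powr (1 / real m)) ^ m = a"
  using assms by (cases "a = 0") (auto simp: powr_powr simp flip: powr_realpow)

text \<open>
  The Hoelder inequality for the indicator of \<open>R\<close> on the edges in \<open>F\<close> and the constant \<open>1\<close> on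
  the other edges, raised to the power \<open>|E(G)|\<close> to clear the roots. The base of the last factor is
  the number of all labellings.
\<close>
lemma weakly_holder_labellings:
  fixes I J :: "nat set"
  assumes G: "bipartite_graph G" and holder: "weakly_holder G"
    and F: "F \<subseteq># edges G" and I: "finite I" and J: "finite J"
  shows "card (labellings G F I J R) ^ size (edges G)
           \<le> card (labellings G (edges G) I J R) ^ size F
              * (card I ^ card (lpart G) * card J ^ card (rpart G)) ^ (size (edges G) - size F)"
proof (cases "edges G = {#}")
  case True
  with F show ?thesis by simp
next
  case False
  define m where "m = size (edges G)"
  define a where "a = real (card (labellings G (edges G) I J R)) powr (1 / real m)"
  define b where "b = real (card I ^ card (lpart G) * card J ^ card (rpart G)) powr (1 / real m)"
  define \<chi> :: "nat \<times> nat \<Rightarrow> real" where "\<chi> = (\<lambda>p. of_bool (R (fst p) (snd p)))"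
  define w where "w = (\<lambda>(e :: 'a \<times> 'a, k). if k < count F e then \<chi> else (\<lambda>_. 1))"
  have m: "m > 0" using False by (simp add: m_def nonempty_has_size[symmetric])
  have ec: "edge_copies G = copies (edges G)"
    by (simp add: edge_copies_def copies_def)
  have lhs: "(\<Prod>((u, v), k)\<in>edge_copies G. w ((u, v), k) (x u, y v))
      = (\<Prod>(u, v)\<in>#F. of_bool (R (x u) (y v)))" for x y
  proof -
    have "(\<Prod>((u, v), k)\<in>edge_copies G. w ((u, v), k) (x u, y v))
        = (\<Prod>(e, k)\<in>copies (edges G).
             if k < count F e then \<chi> (x (fst e), y (snd e)) else 1)"
      unfolding ec by (rule prod.cong) (auto simp: w_def)
    also have "\<dots> = (\<Prod>e\<in>#F. \<chi> (x (fst e), y (snd e)))"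
      by (simp add: prod_copies_if[OF F])
    finally show ?thesis by (simp add: \<chi>_def case_prod_unfold)
  qed
  have norm_\<chi>: "r_norm G I J \<chi> = a"
    using sum_indicator_weights[OF G I J, of R "edges G"]
    by (simp add: r_norm_def hom_sum_def a_def m_def \<chi>_def)
  have norm_1: "r_norm G I J (\<lambda>_. 1) = b"
    using G by (simp add: r_norm_def hom_sum_def b_def m_def case_prod_unfold card_PiE
        bipartite_graph_def)
  have rhs: "(\<Prod>e\<in>edge_copies G. r_norm G I J (w e)) = a ^ size F * b ^ (m - size F)"
  proof -
    have "(\<Prod>e\<in>edge_copies G. r_norm G I J (w e))
        = (\<Prod>(e, k)\<in>copies (edges G). if k < count F e then a else b)"
      unfolding ec by (rule prod.cong) (auto simp: w_def norm_\<chi> norm_1)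
    then show ?thesis by (simp add: prod_copies_if[OF F] m_def)
  qed
  have "real (card (labellings G F I J R)) \<le> a ^ size F * b ^ (m - size F)"
    using holder[unfolded weakly_holder_def, rule_format, OF I J, of w]
    by (simp only: lhs rhs sum_indicator_weights[OF G I J])
  then have "real (card (labellings G F I J R)) ^ m \<le> (a ^ size F * b ^ (m - size F)) ^ m"
    by (intro power_mono) auto
  also have "\<dots> = (a ^ m) ^ size F * (b ^ m) ^ (m - size F)"
    by (simp add: power_mult_distrib mult.commute flip: power_mult)
  also have "a ^ m = real (card (labellings G (edges G) I J R))"
    unfolding a_def by (rule powr_inverse_power) (use m in auto)
  also have "b ^ m = real (card I ^ card (lpart G) * card J ^ card (rpart G))"
    unfolding b_def by (rule powr_inverse_power) (use m in auto)
  finally have "real (card (labellings G F I J R) ^ m)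
      \<le> real (card (labellings G (edges G) I J R) ^ size F
          * (card I ^ card (lpart G) * card J ^ card (rpart G)) ^ (m - size F))"
    by simp
  then show ?thesis unfolding m_def of_nat_le_iff .
qed

section \<open>Density of subgraphs\<close>

text \<open>
  Labels that agree along every edge agree along every path, so one label determines all others.
\<close>
lemma card_labellings_eq_connected:
  assumes G: "bipartite_graph G" and conn: "connected_bigraph G" and r: "r \<in> verts G"
    and I: "finite I"
  shows "card (labellings G (edges G) I I (=)) \<le> card I"
proof (rule surj_card_le[OF I], rule subsetI)
  fix p assume p: "p \<in> labellings G (edges G) I I (=)"
  obtain x y where p_eq: "p = (x, y)" by (cases p)
  have xy: "x \<in> lpart G \<rightarrow>\<^sub>E I" "y \<in> rpart G \<rightarrow>\<^sub>E I"
    and eq: "\<And>u v. (u, v) \<in># edges G \<Longrightarrow> x u = y v"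
    using p by (auto simp: labellings_def p_eq)
  (* the two halves of the labelling glued together, so that paths can be followed *)
  define z where "z a = (if a \<in> lpart G then x a else y a)" for a
  have edge: "z u = z v" if "(u, v) \<in># edges G" for u v
  proof -
    from that G have "u \<in> lpart G" "v \<notin> lpart G"
      by (auto simp: bipartite_graph_def)
    with eq[OF that] show ?thesis by (simp add: z_def)
  qed
  have const: "z v = z r" if "v \<in> verts G" for v
  proof -
    have "(adjacent G)\<^sup>*\<^sup>* r v"
      using conn r that by (auto simp: connected_bigraph_def)
    then show ?thesis
    proof induction
      case (step a b)
      then show ?case using edge by (auto simp: adjacent_def)
    qed simp
  qed
  have "x a = restrict (\<lambda>_. z r) (lpart G) a" for a
    using xy(1) const[of a] by (cases "a \<in> lpart G") (auto simp: z_def verts_def)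
  moreover have "y a = restrict (\<lambda>_. z r) (rpart G) a" for a
  proof (cases "a \<in> rpart G")
    case True
    with G have "a \<notin> lpart G" by (auto simp: bipartite_graph_def)
    with True const[of a] show ?thesis by (auto simp: z_def verts_def)
  next
    case False
    with xy(2) show ?thesis by (auto simp: PiE_def extensional_def)
  qed
  moreover have "z r \<in> I"
    using xy r by (auto simp: z_def verts_def)
  ultimately show "p \<in> (\<lambda>c. (restrict (\<lambda>_. c) (lpart G), restrict (\<lambda>_. c) (rpart G))) ` I"
    unfolding p_eq by (intro image_eqI[of _ _ "z r"]) auto
qed

lemma card_PiE_fixed:
  assumes "finite A" "B \<subseteq> A"
  shows "card (PiE A (\<lambda>a. if a \<in> B then {c} else I)) = card I ^ (card A - card B)"
proof -
  have "card (PiE A (\<lambda>a. if a \<in> B then {c} else I)) = (\<Prod>a\<in>A. if a \<in> B then 1 else card I)"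
    using assms(1) by (subst card_PiE) (auto intro: prod.cong)
  also have "\<dots> = (\<Prod>a\<in>A - B. card I)"
    using assms by (intro prod.mono_neutral_cong_right) auto
  also have "\<dots> = card I ^ (card A - card B)"
    using assms by (simp add: card_Diff_subset finite_subset)
  finally show ?thesis .
qed

lemma card_verts:
  assumes "bipartite_graph G"
  shows "card (verts G) = card (lpart G) + card (rpart G)"
  using assms by (auto simp: bipartite_graph_def verts_def intro: card_Un_disjoint)

text \<open>
  A labelling that is constant on the vertices of \<open>H\<close> is free on the remaining vertices of \<open>G\<close>.
\<close>
lemma card_labellings_eq_ge:
  assumes G: "bipartite_graph G" and H: "subgraph H G" and ne: "verts H \<noteq> {}" and I: "finite I"
  shows "card I * card I ^ (card (verts G) - card (verts H))
           \<le> card (labellings G (edges H) I I (=))"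
proof -
  define L where "L c = PiE (lpart G) (\<lambda>a. if a \<in> lpart H then {c} else I)
      \<times> PiE (rpart G) (\<lambda>b. if b \<in> rpart H then {c} else I)" for c
  have fin: "finite (lpart G)" "finite (rpart G)"
    using G by (auto simp: bipartite_graph_def)
  have sub: "lpart H \<subseteq> lpart G" "rpart H \<subseteq> rpart G" and HB: "bipartite_graph H"
    using H by (auto simp: subgraph_def)
  have le: "card (lpart H) \<le> card (lpart G)" "card (rpart H) \<le> card (rpart G)"
    using fin sub by (auto intro: card_mono)
  have finL: "finite (L c)" for c
    unfolding L_def using fin I by (intro finite_cartesian_product finite_PiE) auto
  have card_L: "card (L c) = card I ^ (card (verts G) - card (verts H))" for c
  proof -
    have "card (L c) = card I ^ ((card (lpart G) - card (lpart H))
        + (card (rpart G) - card (rpart H)))"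
      unfolding L_def card_cartesian_product
      using fin sub by (simp only: card_PiE_fixed power_add)
    then show ?thesis using le by (simp add: card_verts G HB)
  qed
  have disj: "L c \<inter> L d = {}" if cd: "c \<noteq> d" for c d
  proof -
    from ne consider a where "a \<in> lpart H" | b where "b \<in> rpart H"
      by (auto simp: verts_def)
    then show ?thesis
    proof cases
      case 1
      then have "fst p a = c" if "p \<in> L c" for p c
        using sub that by (force simp: L_def PiE_def Pi_def)
      with cd show ?thesis by blast
    next
      case 2
      then have "snd p b = c" if "p \<in> L c" for p c
        using sub that by (force simp: L_def PiE_def Pi_def)
      with cd show ?thesis by blast
    qed
  qed
  have incl: "L c \<subseteq> labellings G (edges H) I I (=)" if c: "c \<in> I" for c
  proof
    fix p assume "p \<in> L c"
    then obtain x y where p: "p = (x, y)"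
      and x: "x \<in> PiE (lpart G) (\<lambda>a. if a \<in> lpart H then {c} else I)"
      and y: "y \<in> PiE (rpart G) (\<lambda>b. if b \<in> rpart H then {c} else I)"
      by (auto simp: L_def)
    have xc: "x a = c" if "a \<in> lpart H" for a
      using PiE_mem[OF x, of a] sub that by auto
    have yc: "y b = c" if "b \<in> rpart H" for b
      using PiE_mem[OF y, of b] sub that by auto
    have "x \<in> lpart G \<rightarrow>\<^sub>E I" "y \<in> rpart G \<rightarrow>\<^sub>E I"
      using x y c by (auto simp: PiE_iff split: if_splits)
    moreover have "x u = y v" if "(u, v) \<in># edges H" for u v
    proof -
      have "u \<in> lpart H" "v \<in> rpart H"
        using HB that by (auto simp: bipartite_graph_def)
      then show ?thesis by (simp add: xc yc)
    qed
    ultimately show "p \<in> labellings G (edges H) I I (=)"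
      by (auto simp: labellings_def p)
  qed
  have "card I * card I ^ (card (verts G) - card (verts H)) = card (\<Union>c\<in>I. L c)"
    using I finL disj by (subst card_UN_disjoint) (auto simp: card_L)
  also have "\<dots> \<le> card (labellings G (edges H) I I (=))"
    using incl by (intro card_mono finite_labellings G I) auto
  finally show ?thesis .
qed

lemma weakly_holder_density:
  assumes G: "bipartite_graph G" and holder: "weakly_holder G" and conn: "connected_bigraph G"
    and H: "subgraph H G" and ne: "verts H \<noteq> {}"
  shows "size (edges H) * (card (verts G) - 1) \<le> size (edges G) * (card (verts H) - 1)"
proof -
  define m n f h where "m = size (edges G)" and "n = card (verts G)"
    and "f = size (edges H)" and "h = card (verts H)"
  let ?I = "{0, 1 :: nat}"
  have HB: "bipartite_graph H" and HE: "edges H \<subseteq># edges G" and sub: "verts H \<subseteq> verts G"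
    using H by (auto simp: subgraph_def verts_def)
  have finG: "finite (verts G)"
    using G by (auto simp: bipartite_graph_def verts_def)
  have hn: "h \<le> n" "h > 0"
    using finG sub ne by (auto simp: h_def n_def card_gt_0_iff intro: card_mono finite_subset)
  have fm: "f \<le> m" using HE by (simp add: f_def m_def size_mset_mono)
  obtain r where r: "r \<in> verts G" using ne sub by auto
  have two: "card ?I = 2" by simp
  have "(2 * 2 ^ (n - h)) ^ m \<le> card (labellings G (edges H) ?I ?I (=)) ^ m"
    using card_labellings_eq_ge[OF G H ne, of ?I, unfolded two]
    by (intro power_mono) (simp_all add: n_def h_def)
  also have "\<dots> \<le> card (labellings G (edges G) ?I ?I (=)) ^ f
      * (card ?I ^ card (lpart G) * card ?I ^ card (rpart G)) ^ (m - f)"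
    unfolding m_def f_def by (rule weakly_holder_labellings[OF G holder HE]) auto
  also have "\<dots> \<le> 2 ^ f * (2 ^ n) ^ (m - f)"
    using card_labellings_eq_connected[OF G conn r, of ?I, unfolded two] unfolding two
    by (intro mult_mono power_mono) (simp_all add: n_def card_verts[OF G] power_add)
  finally have "(2 :: nat) ^ ((1 + (n - h)) * m) \<le> 2 ^ (f + n * (m - f))"
    by (simp add: power_add power_mult)
  then have "(1 + (n - h)) * m \<le> f + n * (m - f)"
    by (rule power_le_imp_le_exp[rotated]) simp
  then have "int ((1 + (n - h)) * m) \<le> int (f + n * (m - f))"
    by (simp only: of_nat_le_iff)
  then have "(1 + (int n - int h)) * int m \<le> int f + int n * (int m - int f)"
    by (simp only: of_nat_add of_nat_mult of_nat_1 of_nat_diff[OF hn(1)] of_nat_diff[OF fm])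
  then have "int f * (int n - 1) \<le> int m * (int h - 1)"
    by (simp add: algebra_simps)
  then have "int (f * (n - 1)) \<le> int (m * (h - 1))"
    using hn by (simp add: of_nat_diff)
  then show ?thesis by (simp only: of_nat_le_iff m_def n_def f_def h_def)
qed

section \<open>Equality of degrees\<close>

lemma sum_size_filter_fibres:
  assumes "finite A" "\<forall>e\<in>#M. f e \<in> A"
  shows "(\<Sum>a\<in>A. size {#e \<in># M. f e = a#}) = size M"
  using assms(2)
proof (induction M)
  case (add e M)
  have "(\<Sum>a\<in>A. size {#e' \<in># add_mset e M. f e' = a#})
      = (\<Sum>a\<in>A. size {#e' \<in># M. f e' = a#} + (if f e = a then 1 else 0))"
    by (rule sum.cong) auto
  with add assms(1) show ?case by (simp add: sum.distrib)
qed simp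

lemma degree_lpart:
  assumes "bipartite_graph G" "v \<in> lpart G"
  shows "degree G v = size {#e \<in># edges G. fst e = v#}"
  unfolding degree_def using assms
  by (intro arg_cong[of _ _ size] filter_mset_cong) (auto simp: bipartite_graph_def)

lemma degree_rpart:
  assumes "bipartite_graph G" "v \<in> rpart G"
  shows "degree G v = size {#e \<in># edges G. snd e = v#}"
  unfolding degree_def using assms
  by (intro arg_cong[of _ _ size] filter_mset_cong) (auto simp: bipartite_graph_def)

lemma sum_degree_part:
  assumes G: "bipartite_graph G" and "P = lpart G \<or> P = rpart G"
  shows "(\<Sum>v\<in>P. degree G v) = size (edges G)"
  using assms(2)
proof
  assume P: "P = lpart G"
  have "(\<Sum>v\<in>P. degree G v) = (\<Sum>v\<in>P. size {#e \<in># edges G. fst e = v#})"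
    by (rule sum.cong) (auto simp: P degree_lpart[OF G])
  also have "\<dots> = size (edges G)"
    using G by (intro sum_size_filter_fibres) (auto simp: P bipartite_graph_def)
  finally show ?thesis .
next
  assume P: "P = rpart G"
  have "(\<Sum>v\<in>P. degree G v) = (\<Sum>v\<in>P. size {#e \<in># edges G. snd e = v#})"
    by (rule sum.cong) (auto simp: P degree_rpart[OF G])
  also have "\<dots> = size (edges G)"
    using G by (intro sum_size_filter_fibres) (auto simp: P bipartite_graph_def)
  finally show ?thesis .
qed

lemma card_labellings_zero:
  fixes I :: "'i :: zero set" and J :: "'j :: zero set"
  assumes G: "bipartite_graph G" and iso: "no_isolated_vertices G"
  shows "card (labellings G (edges G) I J (\<lambda>i j. i = 0 \<and> j = 0)) \<le> 1"
proof -
  have end_edge: "\<exists>e\<in>#edges G. fst e = v \<or> snd e = v" if "v \<in> verts G" for v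
  proof -
    have "{#e \<in># edges G. fst e = v \<or> snd e = v#} \<noteq> {#}"
      using iso that unfolding no_isolated_vertices_def degree_def nonempty_has_size by blast
    then obtain e where "e \<in># {#e \<in># edges G. fst e = v \<or> snd e = v#}" by blast
    then show ?thesis by auto
  qed
  have "labellings G (edges G) I J (\<lambda>i j. i = 0 \<and> j = 0)
      \<subseteq> {(restrict (\<lambda>_. 0) (lpart G), restrict (\<lambda>_. 0) (rpart G))}"
  proof
    fix p assume p: "p \<in> labellings G (edges G) I J (\<lambda>i j. i = 0 \<and> j = 0)"
    obtain x y where p_eq: "p = (x, y)" by (cases p)
    have xy: "x \<in> lpart G \<rightarrow>\<^sub>E I" "y \<in> rpart G \<rightarrow>\<^sub>E J"
      and zero: "\<And>u v. (u, v) \<in># edges G \<Longrightarrow> x u = 0 \<and> y v = 0"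
      using p by (auto simp: labellings_def p_eq)
    have "x u = 0" if "u \<in> lpart G" for u
      using end_edge[of u] that zero G by (fastforce simp: verts_def bipartite_graph_def)
    moreover have "y v = 0" if "v \<in> rpart G" for v
      using end_edge[of v] that zero G by (fastforce simp: verts_def bipartite_graph_def)
    ultimately have "x = restrict (\<lambda>_. 0) (lpart G)" "y = restrict (\<lambda>_. 0) (rpart G)"
      using xy by (auto simp: PiE_def extensional_def fun_eq_iff)
    then show "p \<in> {(restrict (\<lambda>_. 0) (lpart G), restrict (\<lambda>_. 0) (rpart G))}"
      by (simp add: p_eq)
  qed
  then show ?thesis
    by (rule card_mono[rotated, THEN order_trans]) simp_all
qed

text \<open>
  The edges at \<open>v\<close> force the label \<open>0\<close> on \<open>v\<close> only, since the other part has no label but \<open>0\<close>.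
\<close>
lemma weakly_holder_part_degree_le:
  assumes G: "bipartite_graph G" and holder: "weakly_holder G" and iso: "no_isolated_vertices G"
    and P: "P = lpart G \<or> P = rpart G" and v: "v \<in> P"
  shows "card P * degree G v \<le> size (edges G)"
proof -
  define m d where "m = size (edges G)" and "d = degree G v"
  define I J :: "nat set" where "I = (if v \<in> lpart G then {0, 1} else {0})"
    and "J = (if v \<in> lpart G then {0} else {0, 1})"
  define F where "F = {#e \<in># edges G. fst e = v \<or> snd e = v#}"
  let ?R = "\<lambda>i j :: nat. i = (0 :: nat) \<and> j = 0"
  let ?A = "PiE (lpart G) (\<lambda>a. if a \<in> {v} \<inter> lpart G then {0} else I)
    \<times> PiE (rpart G) (\<lambda>b. if b \<in> {v} \<inter> rpart G then {0} else J)"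
  have fin: "finite (lpart G)" "finite (rpart G)" "finite I" "finite J" "finite P"
    using G P by (auto simp: bipartite_graph_def I_def J_def)
  have disj: "lpart G \<inter> rpart G = {}"
    using G by (auto simp: bipartite_graph_def)
  have card_2: "card {0, 1 :: nat} = 2" by simp
  have FE: "F \<subseteq># edges G" and F_size: "size F = d"
    by (auto simp: F_def d_def degree_def)
  have dm: "d \<le> m" unfolding F_size[symmetric] m_def by (rule size_mset_mono[OF FE])
  have P_pos: "card P > 0" using fin v by (auto simp: card_gt_0_iff)
  have incl: "?A \<subseteq> labellings G F I J ?R"
  proof
    fix p assume "p \<in> ?A"
    then obtain x y where p: "p = (x, y)"
      and x: "x \<in> PiE (lpart G) (\<lambda>a. if a \<in> {v} \<inter> lpart G then {0} else I)"
      and y: "y \<in> PiE (rpart G) (\<lambda>b. if b \<in> {v} \<inter> rpart G then {0} else J)"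
      by auto
    have "x \<in> lpart G \<rightarrow>\<^sub>E I" "y \<in> rpart G \<rightarrow>\<^sub>E J"
      using x y by (auto simp: PiE_iff I_def J_def split: if_splits)
    moreover have "x a = 0 \<and> y b = 0" if "(a, b) \<in># F" for a b
    proof -
      have ab: "a \<in> lpart G" "b \<in> rpart G" "a = v \<or> b = v"
        using that G by (auto simp: F_def bipartite_graph_def)
      show ?thesis
        using PiE_mem[OF x ab(1)] PiE_mem[OF y ab(2)] ab P v disj
        by (auto simp: I_def J_def split: if_splits)
    qed
    ultimately show "p \<in> labellings G F I J ?R"
      by (auto simp: labellings_def p)
  qed
  have "card ?A = card I ^ (card (lpart G) - card ({v} \<inter> lpart G))
      * card J ^ (card (rpart G) - card ({v} \<inter> rpart G))"
    unfolding card_cartesian_product using fin by (simp only: card_PiE_fixed Int_lower2)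
  also have "\<dots> = 2 ^ (card P - 1)"
  proof (cases "v \<in> lpart G")
    case True
    with disj P v have "{v} \<inter> lpart G = {v}" "{v} \<inter> rpart G = {}" "P = lpart G" by auto
    with True show ?thesis by (simp add: I_def J_def card_2 del: One_nat_def)
  next
    case False
    with P v have "{v} \<inter> lpart G = {}" "{v} \<inter> rpart G = {v}" "P = rpart G" by auto
    with False show ?thesis by (simp add: I_def J_def card_2 del: One_nat_def)
  qed
  finally have "card ?A = 2 ^ (card P - 1)" .
  then have "2 ^ (card P - 1) \<le> card (labellings G F I J ?R)"
    using card_mono[OF finite_labellings incl] G fin by simp
  then have "(2 ^ (card P - 1)) ^ m \<le> card (labellings G F I J ?R) ^ m"
    by (rule power_mono) simp
  also have "\<dots> \<le> card (labellings G (edges G) I J ?R) ^ d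
      * (card I ^ card (lpart G) * card J ^ card (rpart G)) ^ (m - d)"
    unfolding m_def F_size[symmetric] by (rule weakly_holder_labellings[OF G holder FE fin(3,4)])
  also have "card I ^ card (lpart G) * card J ^ card (rpart G) = 2 ^ card P"
    using P v disj by (cases "v \<in> lpart G") (auto simp: I_def J_def card_2 simp del: One_nat_def)
  also have "card (labellings G (edges G) I J ?R) ^ d * (2 ^ card P) ^ (m - d)
      \<le> 1 ^ d * (2 ^ card P) ^ (m - d)"
    using card_labellings_zero[OF G iso, of I J] by (intro mult_mono power_mono) auto
  finally have "(2 :: nat) ^ ((card P - 1) * m) \<le> 2 ^ (card P * (m - d))"
    by (simp add: power_mult)
  then have "(card P - 1) * m \<le> card P * (m - d)"
    by (rule power_le_imp_le_exp[rotated]) simp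
  then have "int ((card P - 1) * m) \<le> int (card P * (m - d))"
    by (simp only: of_nat_le_iff)
  then have "int (card P * d) \<le> int m"
    using P_pos dm by (simp add: of_nat_diff algebra_simps)
  then show ?thesis by (simp only: of_nat_le_iff m_def d_def)
qed

text \<open>A deficit at one element could not be compensated by the others.\<close>
lemma const_if_le_average:
  fixes f :: "'b \<Rightarrow> nat"
  assumes A: "finite A" and le: "\<And>a. a \<in> A \<Longrightarrow> card A * f a \<le> sum f A" and a: "a \<in> A"
  shows "card A * f a = sum f A"
proof (rule ccontr)
  assume "card A * f a \<noteq> sum f A"
  with le[OF a] have "card A * f a < sum f A" by simp
  with A a le have "(\<Sum>b\<in>A. card A * f b) < (\<Sum>b\<in>A. sum f A)"
    by (intro sum_strict_mono_ex1) auto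
  then show False by (simp flip: sum_distrib_left)
qed

lemma weakly_holder_part_degree_eq:
  assumes G: "bipartite_graph G" and holder: "weakly_holder G" and iso: "no_isolated_vertices G"
    and P: "P = lpart G \<or> P = rpart G" and uv: "u \<in> P" "v \<in> P"
  shows "degree G u = degree G v"
proof -
  have fin: "finite P" using G P by (auto simp: bipartite_graph_def)
  have "card P * degree G a = size (edges G)" if "a \<in> P" for a
    using const_if_le_average[OF fin _ that, of "degree G"]
      weakly_holder_part_degree_le[OF G holder iso P] sum_degree_part[OF G P] by simp
  from this[OF uv(1)] this[OF uv(2)] have "card P * degree G u = card P * degree G v"
    by simp
  moreover have "card P \<noteq> 0" using fin uv by auto
  ultimately show ?thesis by simp
qed

theorem theorem2p10:
  fixes G :: "'a bigraph"
  assumes "bipartite_graph G" and "weakly_holder G"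
  shows "(connected_bigraph G \<longrightarrow>
           (\<forall>H. subgraph H G \<and> card (verts H) \<ge> 2 \<longrightarrow>
              real (size (edges H)) / (real (card (verts H)) - 1)
              \<le> real (size (edges G)) / (real (card (verts G)) - 1))) \<and>
         (no_isolated_vertices G \<longrightarrow>
           (\<forall>u v. u \<in> lpart G \<and> v \<in> lpart G \<or> u \<in> rpart G \<and> v \<in> rpart G \<longrightarrow>
              degree G u = degree G v))"
proof (intro conjI impI allI)
  fix H assume conn: "connected_bigraph G" and "subgraph H G \<and> 2 \<le> card (verts H)"
  then have H: "subgraph H G" and h: "2 \<le> card (verts H)" by auto
  have "verts H \<subseteq> verts G" "finite (verts G)"
    using H assms(1) by (auto simp: subgraph_def verts_def bipartite_graph_def)
  then have n: "2 \<le> card (verts G)" using h card_mono[of "verts G" "verts H"] by simp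
  have "verts H \<noteq> {}" using h by auto
  from weakly_holder_density[OF assms conn H this]
  have "real (size (edges H) * (card (verts G) - 1))
      \<le> real (size (edges G) * (card (verts H) - 1))"
    by (simp only: of_nat_le_iff)
  then have "real (size (edges H)) * (real (card (verts G)) - 1)
      \<le> real (size (edges G)) * (real (card (verts H)) - 1)"
    using h n by (simp add: of_nat_diff)
  with h n show "real (size (edges H)) / (real (card (verts H)) - 1)
      \<le> real (size (edges G)) / (real (card (verts G)) - 1)"
    by (simp add: divide_simps)
next
  fix u v
  assume "no_isolated_vertices G"
    and "u \<in> lpart G \<and> v \<in> lpart G \<or> u \<in> rpart G \<and> v \<in> rpart G"
  then show "degree G u = degree G v"
    using weakly_holder_part_degree_eq[OF assms] by blast
qed

end
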